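(* Let $n,k,s$ be non-negative integers and let $\alpha\in(1,2-1/k]$ be a real number such that $n\ge \alpha k(s+1)+k-1$. If $\mathcal{F}\subseteq\binom{[n]}{k}$ satisfies $\nu(\mathcal{F})=s$, then \[ |\mathcal{F}|\le \binom nk - \binom{n-s}k + \frac{(2-\alpha)k-1}{\alpha k-1}\, s\binom{n-s-1}{k-1}. \]
   Context: $\binom{[n]}{k}$ is the family of all $k$-element subsets of $[n]=\{1,\dots,n\}$. For a family $\mathcal{F}$ of sets, $\nu(\mathcal{F})$ denotes the maximum number of pairwise disjoint members of $\mathcal{F}$ (the size of a maximum matching). *)

theory Defs
  imports Complex_Main
begin

definition k_subsets :: "nat \<Rightarrow> nat \<Rightarrow> nat set set" where
  "k_subsets n k = {A. A \<subseteq> {1..n} \<and> card A = k}"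

definition matching_number :: "'a set set \<Rightarrow> nat" where
  "matching_number F = Max {card M | M. M \<subseteq> F \<and> pairwise disjnt M}"

end

theory Submission
  imports Defs "HOL-Combinatorics.Permutations"
begin

text \<open>
  This is Frankl's argument for the Erdos matching conjecture. Assume F shifted and sort its members
  by their trace on {1..s+1}. The links L 0, ..., L s of the singleton traces are nested and
  cross-dependent: s + 1 pairwise disjoint representatives would extend to a matching of size s + 1.
  Shiftedness puts the shadow of the members with empty trace inside L s, so by the shadow bound
  there are at most s |L s| of them. Averaging over t disjoint (k-1)-sets, with t the integer part of
  (n-s-1)/(k-1), bounds |L 0| + ... + |L (s-1)| + (s+1) |L s| by s max(1, (2s+1)/t) binomials, and
  the hypothesis on n gives t (k-1) >= (alpha k - 1)(s+1), so that max(1, (2s+1)/t) is at most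
  2(k-1)/(alpha k - 1), which is 1 plus the coefficient in the theorem.
\<close>

section \<open>Greedy selection, images under permutations, and averaging\<close>

text \<open>Choose from \<open>B s\<close> first and work down to \<open>B 0\<close>: when
  \<open>B i\<close> is reached, only \<open>s - i\<close> points have been taken, so a fresh one is
  available.\<close>

lemma distinct_choice:
  fixes B :: "nat \<Rightarrow> 'a set"
  assumes "\<And>i. i \<le> s \<Longrightarrow> finite (B i)" and "\<And>i. i \<le> s \<Longrightarrow> s - i < card (B i)"
  shows "\<exists>f. inj_on f {..s} \<and> (\<forall>i\<le>s. f i \<in> B i)"
  using assms
proof (induction s arbitrary: B)
  case 0
  then have "B 0 \<noteq> {}" by fastforce
  then show ?case by auto
next
  case (Suc s)
  have "\<exists>f. inj_on f {..s} \<and> (\<forall>i\<le>s. f i \<in> B (Suc i))"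
    using Suc.prems(1) Suc.prems(2)[of "Suc _"] by (intro Suc.IH) auto
  then obtain f where f: "inj_on f {..s}" "\<And>i. i \<le> s \<Longrightarrow> f i \<in> B (Suc i)" by auto
  have "card (f ` {..s}) < card (B 0)"
    using Suc.prems(2)[of 0] card_image[OF f(1)] by simp
  then have "\<not> B 0 \<subseteq> f ` {..s}"
    by (meson card_mono finite_atMost finite_imageI not_less)
  then obtain x where x: "x \<in> B 0" "x \<notin> f ` {..s}" by auto
  define g where "g = case_nat x f"
  have "inj_on g {..Suc s}"
    using f(1) x(2) by (auto simp: inj_on_def g_def split: nat.splits)
  moreover have "\<forall>i\<le>Suc s. g i \<in> B i"
    using f(2) x(1) by (auto simp: g_def split: nat.splits)
  ultimately show ?case by blast
qed

lemma permutation_between_subsets: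
  assumes "finite Y" "A \<subseteq> Y" "B \<subseteq> Y" "card A = card B"
  obtains p where "p permutes Y" "p ` A = B"
proof -
  have fin: "finite A" "finite B" using assms finite_subset by auto
  obtain f where f: "bij_betw f A B"
    using finite_same_card_bij[OF fin assms(4)] by blast
  have "card (Y - A) = card (Y - B)"
    using assms fin by (simp add: card_Diff_subset)
  then obtain g where g: "bij_betw g (Y - A) (Y - B)"
    using finite_same_card_bij[of "Y - A" "Y - B"] assms(1) by blast
  define p where "p x = (if x \<in> A then f x else if x \<in> Y then g x else x)" for x
  have pA: "bij_betw p A B"
    using f by (subst bij_betw_cong[of A p f]) (auto simp: p_def)
  have "bij_betw p (Y - A) (Y - B)"
    using g by (subst bij_betw_cong[of "Y - A" p g]) (auto simp: p_def)
  then have "bij_betw p (A \<union> (Y - A)) (B \<union> (Y - B))"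
    using pA by (intro bij_betw_combine) auto
  then have "bij_betw p Y Y"
    using assms(2,3) by (simp add: Un_absorb1)
  then have "p permutes Y"
    using assms(2) by (intro bij_imp_permutes) (auto simp: p_def)
  with that pA show thesis by (auto simp: bij_betw_def)
qed

text \<open>A uniformly random permutation of \<open>Y\<close> sends \<open>A\<close> to each subset
  of the same size with equal probability. Composing with a permutation that moves \<open>B\<close>
  to \<open>C\<close> matches the classes \<open>N B\<close> and \<open>N C\<close>, and these
  classes partition all permutations.\<close>

lemma card_permutations_mapping_subset:
  assumes "finite Y" "A \<subseteq> Y" "B \<subseteq> Y" "card A = card B"
  shows "card {p. p permutes Y \<and> p ` A = B} * (card Y choose card A) = fact (card Y)"
proof -
  define N where "N C = {p. p permutes Y \<and> p ` A = C}" for C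
  define K where "K = {C. C \<subseteq> Y \<and> card C = card A}"
  have finN: "finite (N C)" for C
    unfolding N_def using finite_permutations[OF assms(1)] by (rule rev_finite_subset) auto
  have const: "card (N C) = card (N B)" if "C \<in> K" for C
  proof -
    obtain r where r: "r permutes Y" "r ` B = C"
      using permutation_between_subsets[of Y B C] assms \<open>C \<in> K\<close> by (auto simp: K_def)
    have r': "inv r permutes Y" "inv r ` C = B"
      using permutes_inv[OF r(1)] r permutes_inj[OF r(1)] by auto
    have "bij_betw (\<lambda>p. r \<circ> p) (N B) (N C)"
    proof (rule bij_betw_byWitness[where f' = "\<lambda>p. inv r \<circ> p"])
      show "\<forall>p\<in>N B. inv r \<circ> (r \<circ> p) = p" "\<forall>p\<in>N C. r \<circ> (inv r \<circ> p) = p"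
        using permutes_inv_o[OF r(1)] by (auto simp: o_assoc)
      have "q \<circ> p \<in> N E" if "q permutes Y" "q ` D = E" "p \<in> N D" for p q D E
        using that permutes_compose[of p Y q] image_comp[of q p A] by (simp add: N_def)
      then show "(\<lambda>p. r \<circ> p) ` N B \<subseteq> N C" "(\<lambda>p. inv r \<circ> p) ` N C \<subseteq> N B"
        using r r' by blast+
    qed
    then show ?thesis by (simp add: bij_betw_same_card)
  qed
  have "{p. p permutes Y} = (\<Union>C\<in>K. N C)"
    using subsetD[OF assms(2)]
    by (auto simp: N_def K_def card_image permutes_inj_on permutes_in_image)
  then have "fact (card Y) = card (\<Union>C\<in>K. N C)"
    using card_permutations[OF refl assms(1)] by simp
  also have "\<dots> = (\<Sum>C\<in>K. card (N C))"
    using assms(1) finN by (intro card_UN_disjoint) (auto simp: N_def K_def)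
  also have "\<dots> = card K * card (N B)" using const by simp
  also have "card K = card Y choose card A"
    unfolding K_def using assms(1) by (simp add: n_subsets)
  finally show ?thesis by (simp add: N_def mult.commute)
qed

text \<open>Consecutive intervals of length \<open>l\<close> are carried into \<open>Y\<close> by an
  enumeration of \<open>Y\<close>.\<close>

lemma disjoint_blocks:
  assumes "finite Y" "t * l \<le> card Y"
  obtains G where "\<And>j. j < t \<Longrightarrow> G j \<subseteq> Y \<and> card (G j) = l"
    and "\<And>i j. i < t \<Longrightarrow> j < t \<Longrightarrow> i \<noteq> j \<Longrightarrow> disjnt (G i) (G j)"
proof -
  obtain h where h: "bij_betw h {0..<card Y} Y"
    using ex_bij_betw_nat_finite[OF assms(1)] by blast
  then have inj: "inj_on h {0..<card Y}" by (simp add: bij_betw_def)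
  define I where "I j = {j * l..<j * l + l}" for j
  have I: "I j \<subseteq> {0..<card Y}" if "j < t" for j
  proof -
    have "j * l + l \<le> t * l" using that mult_le_mono1[of "Suc j" t l] by simp
    with assms(2) show ?thesis by (auto simp: I_def)
  qed
  have disj: "I i \<inter> I j = {}" if "i < j" for i j
  proof -
    have "i * l + l \<le> j * l" using that mult_le_mono1[of "Suc i" j l] by simp
    then show ?thesis by (auto simp: I_def)
  qed
  show thesis
  proof (rule that[of "\<lambda>j. h ` I j"])
    fix j assume j: "j < t"
    have "card (h ` I j) = l"
      using inj_on_subset[OF inj I[OF j]] by (simp add: card_image I_def)
    then show "h ` I j \<subseteq> Y \<and> card (h ` I j) = l"
      using I[OF j] h by (auto simp: bij_betw_def)
  next
    fix i j assume ij: "i < t" "j < t" "i \<noteq> j"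
    then have "I i \<inter> I j = {}" by (metis disj inf_commute linorder_neqE_nat)
    then show "disjnt (h ` I i) (h ` I j)"
      using inj_on_image_Int[OF inj I I] ij by (metis disjnt_def image_empty)
  qed
qed

text \<open>Averages over all images of a fixed family of t disjoint l-sets under permutations of Y. For a
  single image, cross-dependence and a greedy choice give an i with at most q = s - i of the t sets in
  L i; the weighted count is then at most i t + q (q + s + 1), and q + s + 1 is at most 2 s + 1.\<close>
lemma cross_dependent_sum_le:
  fixes L :: "nat \<Rightarrow> 'a set set"
  assumes Y: "finite Y" and l: "0 < l" and tl: "t * l \<le> card Y"
    and L: "\<And>i B. i \<le> s \<Longrightarrow> B \<in> L i \<Longrightarrow> B \<subseteq> Y \<and> card B = l"
    and nested: "\<And>i j. i \<le> j \<Longrightarrow> j \<le> s \<Longrightarrow> L j \<subseteq> L i"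
    and cross: "\<And>B. (\<And>i. i \<le> s \<Longrightarrow> B i \<in> L i) \<Longrightarrow>
      (\<And>i j. i \<le> s \<Longrightarrow> j \<le> s \<Longrightarrow> i \<noteq> j \<Longrightarrow> disjnt (B i) (B j)) \<Longrightarrow> False"
  shows "t * ((\<Sum>i<s. card (L i)) + (s + 1) * card (L s)) \<le> s * max t (2 * s + 1) * (card Y choose l)"
proof -
  obtain G where G: "\<And>j. j < t \<Longrightarrow> G j \<subseteq> Y \<and> card (G j) = l"
    and Gd: "\<And>i j. i < t \<Longrightarrow> j < t \<Longrightarrow> i \<noteq> j \<Longrightarrow> disjnt (G i) (G j)"
    using disjoint_blocks[OF Y tl] by metis
  define P where "P = {p. p permutes Y}"
  define a where "a p i = card {j \<in> {..<t}. p ` G j \<in> L i}" for p :: "'a \<Rightarrow> 'a" and i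
  define C where "C = card Y choose l"
  have finP: "finite P" using finite_permutations[OF Y] by (simp add: P_def)
  have finL: "finite (L i)" if "i \<le> s" for i
    using Y L[OF that] by (intro finite_subset[of "L i" "Pow Y"]) auto
  \<comment> \<open>Double counting of triples of a permutation, a block and a member of
    \<open>L i\<close> that is the image of the block. Each pair of block and member is realised by
    the same number of permutations, namely \<open>fact (card Y)\<close> divided by
    \<open>C\<close>.\<close>
  have count: "C * (\<Sum>p\<in>P. a p i) = t * card (L i) * fact (card Y)" if i: "i \<le> s" for i
  proof -
    have "(\<Sum>p\<in>P. a p i) = (\<Sum>p\<in>P. \<Sum>j<t. if p ` G j \<in> L i then 1 else 0)"
      by (auto simp: a_def sum.If_cases Int_def)
    also have "\<dots> = (\<Sum>p\<in>P. \<Sum>j<t. \<Sum>B\<in>L i. if p ` G j = B then 1 else 0)"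
      using finL[OF i] by (simp add: sum.delta)
    also have "\<dots> = (\<Sum>j<t. \<Sum>B\<in>L i. \<Sum>p\<in>P. if p ` G j = B then 1 else 0)"
      by (simp add: sum.swap[of _ _ P])
    also have "\<dots> = (\<Sum>j<t. \<Sum>B\<in>L i. card {p. p permutes Y \<and> p ` G j = B})"
      using finP by (simp add: sum.If_cases Int_def P_def)
    finally have "C * (\<Sum>p\<in>P. a p i) =
        (\<Sum>j<t. \<Sum>B\<in>L i. C * card {p. p permutes Y \<and> p ` G j = B})"
      by (simp add: sum_distrib_left)
    also have "\<dots> = (\<Sum>j<t. \<Sum>B\<in>L i. fact (card Y))"
    proof (intro sum.cong refl)
      fix j B assume "j \<in> {..<t}" "B \<in> L i"
      then show "C * card {p. p permutes Y \<and> p ` G j = B} = fact (card Y)"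
        using card_permutations_mapping_subset[OF Y, of "G j" B] G[of j] L[OF i]
        by (auto simp: C_def mult.commute)
    qed
    finally show ?thesis by simp
  qed
  have bound: "(\<Sum>i<s. a p i) + (s + 1) * a p s \<le> s * max t (2 * s + 1)" if p: "p \<in> P" for p
  proof -
    have inj: "inj p" using p by (auto simp: P_def permutes_inj)
    \<comment> \<open>Otherwise distinct blocks could be chosen whose images lie in
      \<open>L 0\<close>, ..., \<open>L s\<close>; as \<open>p\<close> is injective these images are
      disjoint, against \<open>cross\<close>.\<close>
    have "\<exists>i\<le>s. a p i \<le> s - i"
    proof (rule ccontr)
      assume "\<not> ?thesis"
      then have "s - i < a p i" if "i \<le> s" for i using that by (meson not_le)
      then have "\<exists>f. inj_on f {..s} \<and> (\<forall>i\<le>s. f i \<in> {j \<in> {..<t}. p ` G j \<in> L i})"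
        by (intro distinct_choice) (simp_all add: a_def)
      then obtain f where f: "inj_on f {..s}" "\<And>i. i \<le> s \<Longrightarrow> f i < t \<and> p ` G (f i) \<in> L i"
        by auto
      show False
      proof (rule cross[of "\<lambda>i. p ` G (f i)"])
        fix i j assume "i \<le> s" "j \<le> s" "i \<noteq> j"
        then have "disjnt (G (f i)) (G (f j))"
          using f by (intro Gd) (auto dest: inj_onD)
        then show "disjnt (p ` G (f i)) (p ` G (f j))"
          using inj by (auto simp: disjnt_def inj_def)
      qed (use f in auto)
    qed
    then obtain i where i: "i \<le> s" "a p i \<le> s - i" by auto
    define q where "q = s - i"
    have q: "q \<le> s" "s = i + q" using i by (auto simp: q_def)
    have at: "a p j \<le> t" for j
      unfolding a_def using card_mono[of "{..<t}" "{j \<in> {..<t}. p ` G j \<in> L j'}" for j'] by force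
    \<comment> \<open>Nestedness carries the bound at \<open>i\<close> to every later index, in
      particular to the heavily weighted index \<open>s\<close>.\<close>
    have aq: "a p j \<le> q" if "i \<le> j" "j \<le> s" for j
    proof -
      have "a p j \<le> a p i"
        unfolding a_def using nested[OF that] by (intro card_mono) auto
      then show ?thesis using i by (simp add: q_def)
    qed
    have "(\<Sum>j<s. a p j) = (\<Sum>j<i. a p j) + (\<Sum>j=i..<s. a p j)"
      using i(1) by (simp add: lessThan_atLeast0 sum.atLeastLessThan_concat)
    also have "\<dots> \<le> i * t + q * q"
      using sum_bounded_above[of "{..<i}" "a p" t] sum_bounded_above[of "{i..<s}" "a p" q] at aq
      by (intro add_mono) (auto simp: q_def)
    finally have "(\<Sum>j<s. a p j) + (s + 1) * a p s \<le> i * t + q * q + (s + 1) * q"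
      using aq[of s] i(1) by (intro add_mono mult_left_mono) auto
    also have "\<dots> = i * t + q * (q + s + 1)" by (simp add: algebra_simps)
    also have "\<dots> \<le> i * max t (2 * s + 1) + q * max t (2 * s + 1)"
      using q(1) by (intro add_mono mult_left_mono) auto
    also have "\<dots> = s * max t (2 * s + 1)" using q(2) by (simp add: algebra_simps)
    finally show ?thesis .
  qed
  \<comment> \<open>Multiplying by the number of permutations keeps the averaging within the natural
    numbers; this factor is cancelled at the end.\<close>
  have "fact (card Y) * (t * ((\<Sum>i<s. card (L i)) + (s + 1) * card (L s)))
      = (\<Sum>i<s. t * card (L i) * fact (card Y)) + (s + 1) * (t * card (L s) * fact (card Y))"
    by (simp add: sum_distrib_left sum_distrib_right algebra_simps)
  also have "\<dots> = C * ((\<Sum>i<s. \<Sum>p\<in>P. a p i) + (s + 1) * (\<Sum>p\<in>P. a p s))"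
    by (simp add: count[symmetric] sum_distrib_left distrib_left mult.left_commute)
  also have "\<dots> = C * (\<Sum>p\<in>P. (\<Sum>i<s. a p i) + (s + 1) * a p s)"
    by (simp only: sum.distrib sum_distrib_left sum.swap[of _ "{..<s}" P])
  also have "\<dots> \<le> C * (fact (card Y) * (s * max t (2 * s + 1)))"
    using sum_bounded_above[of P, OF bound] card_permutations[OF refl Y]
    by (intro mult_left_mono) (auto simp: P_def)
  also have "\<dots> = fact (card Y) * (s * max t (2 * s + 1) * C)" by simp
  finally show ?thesis by (simp add: C_def)
qed

section \<open>Compression and shifted families\<close>

text \<open>An upper bound rather than an exact matching number: it passes to subfamilies and
  survives compression, which may lower the matching number.\<close>

definition matchings_at_most :: "'a set set \<Rightarrow> nat \<Rightarrow> bool" where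
  "matchings_at_most F s \<longleftrightarrow> (\<forall>M\<subseteq>F. finite M \<longrightarrow> pairwise disjnt M \<longrightarrow> card M \<le> s)"

text \<open>The threshold \<open>a\<close> allows for families living on \<open>{a<..n}\<close>,
  such as the members that avoid \<open>{1..s + 1}\<close>; \<open>a = 0\<close> is ordinary
  shiftedness on the positive integers.\<close>

definition shifted_above :: "nat \<Rightarrow> nat set set \<Rightarrow> bool" where
  "shifted_above a F \<longleftrightarrow>
    (\<forall>A\<in>F. \<forall>j\<in>A. \<forall>i. a < i \<longrightarrow> i < j \<longrightarrow> i \<notin> A \<longrightarrow> insert i (A - {j}) \<in> F)"

definition shadow :: "'a set set \<Rightarrow> 'a set set" where
  "shadow F = {A - {x} | A x. A \<in> F \<and> x \<in> A}"

lemma transpose_image: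
  assumes "j \<in> A" "i \<notin> A"
  shows "transpose i j ` A = insert i (A - {j})"
  using assms by (auto simp: transpose_def image_iff)

lemma transpose_image_absent:
  assumes "j \<notin> A" "i \<notin> A"
  shows "transpose i j ` A = A"
  using assms by (force simp: transpose_def image_iff)

text \<open>The classical (i,j)-shift, written as a map on single members. Leaving a set alone when
  its replacement is already in \<open>F\<close> is what makes the map injective on
  \<open>F\<close>.\<close>

definition compress :: "'a \<Rightarrow> 'a \<Rightarrow> 'a set set \<Rightarrow> 'a set \<Rightarrow> 'a set" where
  "compress i j F A = (if j \<in> A \<and> i \<notin> A \<and> insert i (A - {j}) \<notin> F then insert i (A - {j}) else A)"

lemma inj_on_compress: "inj_on (compress i j F) F"
  by (rule inj_onI) (auto simp: compress_def split: if_splits)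

lemma matchings_at_most_compress:
  assumes "matchings_at_most F s"
  shows "matchings_at_most (compress i j F ` F) s"
  unfolding matchings_at_most_def
proof (intro allI impI)
  fix M assume M: "M \<subseteq> compress i j F ` F" and fin: "finite M" and disj: "pairwise disjnt M"
  show "card M \<le> s"
  proof (cases "M \<subseteq> F")
    case True
    then show ?thesis using assms fin disj by (simp add: matchings_at_most_def)
  next
    case False
    then obtain A where A: "A \<in> M" "A \<notin> F" by auto
    then obtain D where D: "D \<in> F" "j \<in> D" "i \<notin> D" "A = insert i (D - {j})"
      using M by (auto simp: compress_def split: if_splits)
    \<comment> \<open>Since A is the only member of M containing i, applying the transposition to all of M
      undoes the compression and lands in F.\<close>
    define \<tau> where "\<tau> = transpose i j"
    have inj: "inj \<tau>" by (simp add: \<tau>_def)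
    have "\<tau> ` X \<in> F" if "X \<in> M" for X
    proof (cases "X = A")
      case True
      have "A = \<tau> ` D" using D transpose_image[of j D i] by (simp add: \<tau>_def)
      then have "\<tau> ` A = D" by (simp add: \<tau>_def image_comp)
      then show ?thesis using D True by simp
    next
      case False
      then have "i \<notin> X"
        using disj that A(1) D(4) by (force simp: pairwise_def disjnt_def)
      \<comment> \<open>Moved sets contain \<open>i\<close>, so \<open>X\<close> is an unmoved
        member of \<open>F\<close>. If \<open>j\<close> is in \<open>X\<close>, it stayed because
        its replacement is in \<open>F\<close>, and that replacement is the image of
        \<open>X\<close> under \<open>\<tau>\<close>; if not, \<open>\<tau>\<close> fixes
        \<open>X\<close>.\<close>
      with M that show ?thesis
        using transpose_image[of j X i] transpose_image_absent[of j X i]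
        by (cases "j \<in> X") (auto simp: \<tau>_def compress_def split: if_splits)
    qed
    then have "(`) \<tau> ` M \<subseteq> F" by auto
    moreover have "pairwise disjnt ((`) \<tau> ` M)"
      using disj by (auto simp: pairwise_def disjnt_def image_Int[OF inj, symmetric])
    moreover have "card ((`) \<tau> ` M) = card M"
      by (intro card_image inj_onI) (simp add: inj_image_eq_iff[OF inj])
    moreover have "finite ((`) \<tau> ` M)" using fin by simp
    ultimately show ?thesis using assms unfolding matchings_at_most_def by metis
  qed
qed

lemma finite_k_subsets: "finite (k_subsets n k)"
  by (rule finite_subset[of _ "Pow {1..n}"]) (auto simp: k_subsets_def)

text \<open>A family of least total element sum among all candidates is shifted, since compressing it
  would lower that sum.\<close>
lemma exists_shifted:
  assumes F: "F \<subseteq> k_subsets n k" and m: "matchings_at_most F s"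
  obtains F' where "F' \<subseteq> k_subsets n k" "card F' = card F" "matchings_at_most F' s"
    "shifted_above 0 F'"
proof -
  define Q where "Q F' \<longleftrightarrow> F' \<subseteq> k_subsets n k \<and> card F' = card F \<and> matchings_at_most F' s" for F'
  define w where "w F' = (\<Sum>A\<in>F'. \<Sum>A)" for F' :: "nat set set"
  have "Q F" using assms by (simp add: Q_def)
  from ex_has_least_nat[where P = Q and m = w, OF this]
  obtain F' where Q: "Q F'" and least: "\<And>H. Q H \<Longrightarrow> w F' \<le> w H" by blast
  have fin: "finite F'" using Q finite_subset[OF _ finite_k_subsets] by (auto simp: Q_def)
  have finA: "finite A" if "A \<in> F'" for A
    using Q that by (auto simp: Q_def k_subsets_def intro: finite_subset)
  have "shifted_above 0 F'"
    unfolding shifted_above_def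
  proof (intro ballI allI impI, rule ccontr)
    fix A j i assume A: "A \<in> F'" "j \<in> A" "0 < i" "i < j" "i \<notin> A" "insert i (A - {j}) \<notin> F'"
    let ?c = "compress i j F'"
    have c: "?c X \<in> k_subsets n k \<and> \<Sum>(?c X) \<le> \<Sum>X" if "X \<in> F'" for X
    proof (cases "?c X = X")
      case False
      then have X: "j \<in> X" "i \<notin> X" "?c X = insert i (X - {j})"
        by (auto simp: compress_def split: if_splits)
      have "X \<in> k_subsets n k" using Q that by (auto simp: Q_def)
      then have "?c X \<in> k_subsets n k"
        using X A(3,4) finA[OF that] card_Suc_Diff1[of X j] by (auto simp: k_subsets_def)
      moreover have "\<Sum>(?c X) \<le> \<Sum>X"
        using X A(4) finA[OF that] sum.remove[of X j "\<lambda>x. x"] by simp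
      ultimately show ?thesis by simp
    qed (use Q that in \<open>auto simp: Q_def\<close>)
    have "?c A = insert i (A - {j})" using A by (simp add: compress_def)
    then have "\<Sum>(?c A) < \<Sum>A"
      using A finA sum.remove[of A j "\<lambda>x. x"] by simp
    then have "(\<Sum>X\<in>F'. \<Sum>(?c X)) < w F'"
      unfolding w_def using fin A(1) c by (intro sum_strict_mono_ex1) blast+
    then have "w (?c ` F') < w F'"
      by (simp add: w_def sum.reindex[OF inj_on_compress])
    moreover have "Q (?c ` F')"
      using Q c matchings_at_most_compress card_image[OF inj_on_compress, of i j F']
      by (auto simp: Q_def)
    ultimately show False using least by fastforce
  qed
  with Q that show thesis by (auto simp: Q_def)
qed

section \<open>The shadow bound for shifted families\<close>

lemma finite_shadow:
  assumes "finite F" "\<And>A. A \<in> F \<Longrightarrow> finite A"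
  shows "finite (shadow F)"
proof -
  have "shadow F = (\<Union>A\<in>F. (\<lambda>x. A - {x}) ` A)" by (auto simp: shadow_def)
  then show ?thesis using assms by auto
qed

text \<open>Double counting of pairs of a member and one of its points. A member yields
  \<open>k\<close> pairs, and a shadow set, having \<open>k - 1\<close> points, extends by at most
  \<open>card Y - (k - 1)\<close> points, which is at most \<open>k * s\<close>.\<close>

lemma card_le_shadow_small:
  assumes Y: "finite Y" and F: "\<And>A. A \<in> F \<Longrightarrow> A \<subseteq> Y \<and> card A = k"
    and k: "0 < k" and small: "card Y < k * (s + 1)"
  shows "card F \<le> s * card (shadow F)"
proof -
  have finF: "finite F" using F Y by (intro finite_subset[of F "Pow Y"]) auto
  have finS: "finite (shadow F)"
    using finF F Y by (intro finite_shadow) (auto intro: finite_subset)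
  define E where "E = (SIGMA A:F. A)"
  have "card E = (\<Sum>A\<in>F. card A)"
    unfolding E_def using finF F Y by (intro card_SigmaI) (auto intro: finite_subset)
  also have "\<dots> = k * card F" using F by simp
  finally have "card E = k * card F" .
  moreover have "card E \<le> card (SIGMA D:shadow F. Y - D)"
  proof (rule card_inj_on_le)
    show "inj_on (\<lambda>(A, x). (A - {x}, x)) E" by (auto simp: inj_on_def E_def)
    show "(\<lambda>(A, x). (A - {x}, x)) ` E \<subseteq> (SIGMA D:shadow F. Y - D)"
      using F by (auto simp: E_def shadow_def)
    show "finite (SIGMA D:shadow F. Y - D)" using Y finS by auto
  qed
  moreover have "card (SIGMA D:shadow F. Y - D) = (\<Sum>D\<in>shadow F. card (Y - D))"
    using Y finS by (intro card_SigmaI) auto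
  moreover have "(\<Sum>D\<in>shadow F. card (Y - D)) \<le> card (shadow F) * (k * s)"
  proof (rule sum_bounded_above[where 'a = nat, simplified])
    fix D assume "D \<in> shadow F"
    then obtain A x where A: "A \<in> F" "x \<in> A" "D = A - {x}" by (auto simp: shadow_def)
    then have D: "D \<subseteq> Y" "card D = k - 1" "finite D" using F Y k
      by (auto simp: card_Diff_singleton dest: finite_subset[of A Y])
    then have "card (Y - D) = card Y - (k - 1)" by (simp add: card_Diff_subset)
    then show "card (Y - D) \<le> k * s" using small k by (simp add: algebra_simps)
  qed
  ultimately have "k * card F \<le> card (shadow F) * (k * s)" by linarith
  also have "\<dots> = k * (s * card (shadow F))" by (simp add: algebra_simps)
  finally have "k * card F \<le> k * (s * card (shadow F))" .
  then show ?thesis using k by simp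
qed

lemma card_Union_uniform:
  assumes "finite M" "pairwise disjnt M" "\<And>A. A \<in> M \<Longrightarrow> finite A \<and> card A = k"
  shows "card (\<Union>M) = k * card M"
  using assms by (subst card_Union_disjoint) auto

text \<open>Induction on the largest point \<open>z\<close> of the ground set. Small ground sets are
  covered by \<open>card_le_shadow_small\<close>; otherwise the members without \<open>z\<close> and
  the link of \<open>z\<close> both inherit the hypotheses, and their shadows give disjoint parts of
  \<open>shadow F\<close>.\<close>

lemma card_le_shadow:
  assumes "\<And>A. A \<in> F \<Longrightarrow> A \<subseteq> {a<..n} \<and> card A = k" and "0 < k"
    and "shifted_above a F" and "matchings_at_most F s"
  shows "card F \<le> s * card (shadow F)"
  using assms
proof (induction n arbitrary: F k)
  case 0
  then show ?case by (intro card_le_shadow_small[of "{a<..0}"]) auto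
next
  case (Suc n)
  have finF: "finite F" using Suc.prems(1) by (intro finite_subset[of F "Pow {a<..Suc n}"]) auto
  have finA: "finite A" if "A \<in> F" for A using Suc.prems(1)[OF that] by (auto intro: finite_subset)
  show ?case
  proof (cases "card {a<..Suc n} < k * (s + 1)")
    case True
    then show ?thesis using Suc.prems by (intro card_le_shadow_small[of "{a<..Suc n}"]) auto
  next
    case large: False
    show ?thesis
    \<comment> \<open>The link of \<open>z\<close> would consist of empty sets here. Instead,
      \<open>F\<close> is itself a matching, and its shadow is nonempty unless \<open>F\<close> is
      empty.\<close>
    proof (cases "k = 1")
      case True
      then have "pairwise disjnt F"
        using Suc.prems(1) by (auto simp: pairwise_def disjnt_def card_1_singleton_iff)
      then have "card F \<le> s" using Suc.prems(4) finF by (simp add: matchings_at_most_def)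
      moreover have "0 < card (shadow F)" if nonempty: "F \<noteq> {}"
      proof -
        obtain A where A: "A \<in> F" using nonempty by auto
        then obtain x where "x \<in> A" using Suc.prems(1)[OF A] True by fastforce
        with A have "A - {x} \<in> shadow F" by (auto simp: shadow_def)
        then show ?thesis using finite_shadow[OF finF finA] by (auto simp: card_gt_0_iff)
      qed
      ultimately show ?thesis
        by (cases "F = {}") (simp, metis One_nat_def Suc_leI mult_le_mono2 mult_1_right order_trans)
    next
      case False
      then have k: "1 < k" using Suc.prems(2) by simp
      define z where "z = Suc n"
      define F0 where "F0 = {A \<in> F. z \<notin> A}"
      define F1 where "F1 = {B. z \<notin> B \<and> insert z B \<in> F}"
      have F0: "card F0 \<le> s * card (shadow F0)"
      proof (rule Suc.IH)
        show "A \<subseteq> {a<..n} \<and> card A = k" if "A \<in> F0" for A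
          using that Suc.prems(1)[of A] by (auto simp: F0_def z_def le_Suc_eq)
        show "shifted_above a F0"
          using Suc.prems(1,3) unfolding shifted_above_def F0_def z_def by fastforce
        show "matchings_at_most F0 s"
          using Suc.prems(4) by (auto simp: F0_def matchings_at_most_def)
      qed fact
      have memF1: "B \<subseteq> {a<..n} \<and> card B = k - 1 \<and> finite B" if "B \<in> F1" for B
      proof -
        have *: "insert z B \<in> F" "z \<notin> B" using that by (auto simp: F1_def)
        then have "finite B" using finA[of "insert z B"] by simp
        with * Suc.prems(1)[OF *(1)] show ?thesis by (auto simp: z_def le_Suc_eq)
      qed
      have F1: "card F1 \<le> s * card (shadow F1)"
      proof (rule Suc.IH)
        show "A \<subseteq> {a<..n} \<and> card A = k - 1" if "A \<in> F1" for A
          using memF1[OF that] by simp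
        show "shifted_above a F1"
          unfolding shifted_above_def
        proof (intro ballI allI impI)
          fix B j i assume *: "B \<in> F1" "j \<in> B" "a < i" "i < j" "i \<notin> B"
          then have "z \<noteq> j" "z \<noteq> i" "j < z" using memF1[OF *(1)] by (auto simp: z_def)
          moreover have "insert i (insert z B - {j}) \<in> F"
            using Suc.prems(3) * \<open>z \<noteq> i\<close> by (auto simp: shifted_above_def F1_def)
          moreover have "insert i (insert z B - {j}) = insert z (insert i (B - {j}))"
            using \<open>z \<noteq> j\<close> by auto
          ultimately show "insert i (B - {j}) \<in> F1" using * by (auto simp: F1_def)
        qed
        show "matchings_at_most F1 s"
          unfolding matchings_at_most_def
        proof (intro allI impI, rule ccontr)
          fix M0 assume M0: "M0 \<subseteq> F1" "finite M0" "pairwise disjnt M0" "\<not> card M0 \<le> s"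
          then have "s + 1 \<le> card M0" by simp
          then obtain M where M: "M \<subseteq> M0" "card M = s + 1"
            by (meson obtain_subset_with_card_n)
          then have finM: "finite M" and dM: "pairwise disjnt M" and MF: "M \<subseteq> F1"
            using M0 by (auto intro: finite_subset pairwise_subset)
          have BM: "B \<subseteq> {a<..z} \<and> card B = k - 1 \<and> finite B" if "B \<in> M" for B
            using memF1[OF subsetD[OF MF that]] by (auto simp: z_def)
          have "card (\<Union>M) = (k - 1) * card M"
            using BM by (intro card_Union_uniform[OF finM dM]) blast
          then have U: "\<Union>M \<subseteq> {a<..z}" "finite (\<Union>M)" "card (\<Union>M) = (k - 1) * (s + 1)"
            using BM finM M(2) by auto
          \<comment> \<open>The sets in \<open>M\<close> cover \<open>(k - 1) * (s + 1)\<close>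
            points, and the ground set, including \<open>z\<close>, has at least
            \<open>k * (s + 1)\<close>. So \<open>s + 1\<close> spare points remain, one for each
            set.\<close>
          have "card ({a<..z} - \<Union>M) = card {a<..z} - (k - 1) * (s + 1)"
            using U by (simp add: card_Diff_subset)
          moreover have "(k - 1) * (s + 1) + (s + 1) = k * (s + 1)" using k
            by (metis Suc_pred' Suc.prems(2) mult_Suc add.commute)
          ultimately have "card M \<le> card ({a<..z} - \<Union>M)"
            using large M(2) by (simp only: z_def)
          then obtain g where g: "inj_on g M" "g ` M \<subseteq> {a<..z} - \<Union>M"
            using card_le_inj[OF finM] by (metis finite_Diff finite_greaterThanAtMost)
          \<comment> \<open>Shiftedness lets each B in M be completed by its own unused point instead of z.\<close>
          define h where "h B = insert (g B) B" for B
          have hF: "h B \<in> F" if "B \<in> M" for B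
          proof (cases "g B = z")
            case True
            then show ?thesis using that MF by (auto simp: h_def F1_def)
          next
            case False
            then have "g B < z" "a < g B" "g B \<notin> B" using g(2) that by force+
            moreover have "insert z B \<in> F" "z \<notin> B" using that MF by (auto simp: F1_def)
            ultimately have "insert (g B) (insert z B - {z}) \<in> F"
              using Suc.prems(3) False by (auto simp: shifted_above_def)
            then show ?thesis using \<open>z \<notin> B\<close> by (simp add: h_def)
          qed
          have hd: "disjnt (h B) (h D)" if "B \<in> M" "D \<in> M" "B \<noteq> D" for B D
          proof -
            have "disjnt B D" using dM that by (auto simp: pairwise_def)
            moreover have "g B \<noteq> g D" using g(1) that by (auto dest: inj_onD)
            moreover have "g B \<notin> D" "g D \<notin> B" using g(2) that by auto
            ultimately show ?thesis by (auto simp: h_def disjnt_def)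
          qed
          have "inj_on h M"
            using hd by (force simp: inj_on_def h_def disjnt_def)
          then have "card (h ` M) = s + 1" using M(2) by (simp add: card_image)
          moreover have "pairwise disjnt (h ` M)" using hd by (auto simp: pairwise_def)
          moreover have "h ` M \<subseteq> F" using hF by blast
          moreover have "finite (h ` M)" using finM by simp
          ultimately have "s + 1 \<le> s"
            using Suc.prems(4) unfolding matchings_at_most_def by metis
          then show False by simp
        qed
      qed (use k in simp)
      have "A \<in> F0 \<union> insert z ` F1" if "A \<in> F" for A
      proof (cases "z \<in> A")
        case True
        then have "A - {z} \<in> F1" "A = insert z (A - {z})"
          using that by (auto simp: F1_def insert_absorb)
        then show ?thesis by blast
      qed (use that in \<open>simp add: F0_def\<close>)
      then have split: "F = F0 \<union> insert z ` F1" by (auto simp: F0_def F1_def)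
      have injz: "inj_on (insert z) {B. z \<notin> B}" by (auto simp: inj_on_def)
      have "finite (insert z ` F1)" using finF split by (metis finite_Un)
      moreover have "inj_on (insert z) F1"
        by (rule inj_on_subset[OF injz]) (auto simp: F1_def)
      ultimately have finF1: "finite F1" by (rule finite_imageD)
      have "card F = card (F0 \<union> insert z ` F1)" using split by (rule arg_cong)
      also have "\<dots> \<le> card F0 + card (insert z ` F1)" by (rule card_Un_le)
      also have "\<dots> \<le> card F0 + card F1" using card_image_le[OF finF1] by simp
      also have "\<dots> \<le> s * (card (shadow F0) + card (shadow F1))"
        using F0 F1 by (simp add: algebra_simps)
      \<comment> \<open>Sets in \<open>shadow F0\<close> avoid \<open>z\<close>, while those built
        from \<open>shadow F1\<close> contain it.\<close>
      also have "card (shadow F0) + card (shadow F1) = card (shadow F0 \<union> insert z ` shadow F1)"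
      proof -
        have "inj_on (insert z) (shadow F1)"
          by (rule inj_on_subset[OF injz]) (auto simp: shadow_def F1_def)
        moreover have "shadow F0 \<inter> insert z ` shadow F1 = {}"
          by (auto simp: shadow_def F0_def)
        moreover have "finite (shadow F0)" using finF finA
          by (intro finite_shadow) (auto simp: F0_def)
        moreover have "finite (shadow F1)" using finF1 memF1 by (intro finite_shadow) auto
        ultimately show ?thesis by (simp add: card_Un_disjoint card_image)
      qed
      also have "\<dots> \<le> card (shadow F)"
      proof (rule card_mono[OF finite_shadow[OF finF finA]])
        have "insert z (B - {x}) \<in> shadow F" if "B \<in> F1" "x \<in> B" for B x
        proof -
          have "insert z (B - {x}) = insert z B - {x}" using that by (auto simp: F1_def)
          then show ?thesis using that by (auto simp: shadow_def F1_def)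
        qed
        then show "shadow F0 \<union> insert z ` shadow F1 \<subseteq> shadow F"
          by (auto simp: shadow_def F0_def)
      qed auto
      finally show ?thesis by simp
    qed
  qed
qed

section \<open>Matching number and decomposition by traces on \<open>{1..s + 1}\<close>\<close>

lemma matchings_at_most_matching_number:
  assumes "finite F"
  shows "matchings_at_most F (matching_number F)"
  unfolding matchings_at_most_def
proof (intro allI impI)
  fix M assume "M \<subseteq> F" "pairwise disjnt M"
  moreover have "finite {card M | M. M \<subseteq> F \<and> pairwise disjnt M}"
    by (rule finite_subset[of _ "card ` Pow F"]) (use assms in auto)
  ultimately show "card M \<le> matching_number F"
    unfolding matching_number_def by (intro Max_ge) auto
qed

text \<open>Index \<open>i\<close> stands for the point \<open>Suc i\<close>, so that the links are
  numbered 0 to \<open>s\<close> as in \<open>cross_dependent_sum_le\<close>.\<close>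

definition link :: "nat \<Rightarrow> nat set set \<Rightarrow> nat \<Rightarrow> nat set set" where
  "link s F i = {B. B \<inter> {1..s + 1} = {} \<and> insert (Suc i) B \<in> F}"

text \<open>Applied both to the given family and to all of \<open>k_subsets n k\<close>, so that the
  classes with trace of size at least 2 can be compared and eliminated.\<close>

lemma card_split_by_trace:
  assumes F: "finite F"
  shows "card F = card {A \<in> F. A \<inter> {1..s + 1} = {}} + card {A \<in> F. 2 \<le> card (A \<inter> {1..s + 1})}
    + (\<Sum>i\<le>s. card (link s F i))"
proof -
  define F0 where "F0 = {A \<in> F. A \<inter> {1..s + 1} = {}}"
  define F2 where "F2 = {A \<in> F. 2 \<le> card (A \<inter> {1..s + 1})}"
  define F1 where "F1 i = {A \<in> F. A \<inter> {1..s + 1} = {Suc i}}" for i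
  have fin: "finite F0" "finite F2" "finite (F1 i)" for i
    using F by (auto simp: F0_def F1_def F2_def)
  have "A \<in> F0 \<union> F2 \<union> (\<Union>i\<le>s. F1 i)" if "A \<in> F" for A
  proof -
    consider "card (A \<inter> {1..s + 1}) = 0" | "card (A \<inter> {1..s + 1}) = 1" | "2 \<le> card (A \<inter> {1..s + 1})"
      by linarith
    then show ?thesis
    proof cases
      case 2
      then obtain x where x: "A \<inter> {1..s + 1} = {x}" by (auto simp: card_1_singleton_iff)
      then have "x \<in> {1..s + 1}" by blast
      then have "x = Suc (x - 1)" "x - 1 \<le> s" by auto
      with x that have "A \<in> F1 (x - 1)" by (simp add: F1_def)
      with \<open>x - 1 \<le> s\<close> show ?thesis by blast
    qed (use that in \<open>auto simp: F0_def F2_def\<close>)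
  qed
  then have "F = F0 \<union> F2 \<union> (\<Union>i\<le>s. F1 i)"
    by (auto simp: F0_def F1_def F2_def)
  then have "card F = card (F0 \<union> F2 \<union> (\<Union>i\<le>s. F1 i))" by simp
  also have "\<dots> = card (F0 \<union> F2) + card (\<Union>i\<le>s. F1 i)"
    using fin by (intro card_Un_disjoint) (auto simp: F0_def F1_def F2_def)
  also have "card (F0 \<union> F2) = card F0 + card F2"
    using fin by (intro card_Un_disjoint) (auto simp: F0_def F2_def)
  also have "card (\<Union>i\<le>s. F1 i) = (\<Sum>i\<le>s. card (F1 i))"
    using fin by (intro card_UN_disjoint) (auto simp: F1_def)
  also have "\<dots> = (\<Sum>i\<le>s. card (link s F i))"
  proof (rule sum.cong[OF refl])
    fix i assume "i \<in> {..s}"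
    then have i: "Suc i \<in> {1..s + 1}" by simp
    have "bij_betw (insert (Suc i)) (link s F i) (F1 i)"
    proof (rule bij_betw_byWitness[where f' = "\<lambda>A. A - {Suc i}"])
      show "\<forall>B\<in>link s F i. insert (Suc i) B - {Suc i} = B"
        using i unfolding link_def by blast
      show *: "\<forall>A\<in>F1 i. insert (Suc i) (A - {Suc i}) = A"
        unfolding F1_def by blast
      show "insert (Suc i) ` link s F i \<subseteq> F1 i"
        using i unfolding link_def F1_def by blast
      show "(\<lambda>A. A - {Suc i}) ` F1 i \<subseteq> link s F i"
      proof (rule image_subsetI)
        fix A assume A: "A \<in> F1 i"
        then have "insert (Suc i) (A - {Suc i}) \<in> F" using * by (simp add: F1_def)
        moreover have "(A - {Suc i}) \<inter> {1..s + 1} = {}" using A unfolding F1_def by blast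
        ultimately show "A - {Suc i} \<in> link s F i" unfolding link_def by blast
      qed
    qed
    then show "card (F1 i) = card (link s F i)" by (simp add: bij_betw_same_card)
  qed
  finally show ?thesis by (simp add: F0_def F2_def)
qed

lemma link_k_subsets:
  assumes "i \<le> s" "s < n" "0 < k"
  shows "link s (k_subsets n k) i = {B. B \<subseteq> {s + 1<..n} \<and> card B = k - 1}"
proof (intro set_eqI iffI)
  fix B assume "B \<in> link s (k_subsets n k) i"
  then have B: "B \<inter> {1..s + 1} = {}" "insert (Suc i) B \<subseteq> {1..n}" "card (insert (Suc i) B) = k"
    by (auto simp: link_def k_subsets_def)
  then have "finite B" "Suc i \<notin> B" using assms by (auto intro: finite_subset)
  moreover have "x \<in> {s + 1<..n}" if "x \<in> B" for x
  proof -
    have "x \<in> {1..n}" "x \<notin> {1..s + 1}" using B that by blast+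
    then show ?thesis by auto
  qed
  ultimately show "B \<in> {B. B \<subseteq> {s + 1<..n} \<and> card B = k - 1}" using B(3) by auto
next
  fix B assume B: "B \<in> {B. B \<subseteq> {s + 1<..n} \<and> card B = k - 1}"
  then have "finite B" by (auto intro: finite_subset)
  moreover have "Suc i \<notin> B" "B \<subseteq> {1..n}" "B \<inter> {1..s + 1} = {}" using B assms(1) by auto
  ultimately show "B \<in> link s (k_subsets n k) i"
    using B assms by (auto simp: link_def k_subsets_def)
qed

text \<open>In the full family each of the \<open>s + 1\<close> links is complete. By Pascal's rule
  one of them merges with the empty-trace class into \<open>(n - s) choose k\<close>, which leaves
  \<open>s\<close> link terms.\<close>

lemma binomial_split_by_trace:
  assumes "s < n" "0 < k"
  shows "n choose k = ((n - s) choose k) + card {A \<in> k_subsets n k. 2 \<le> card (A \<inter> {1..s + 1})}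
    + s * ((n - s - 1) choose (k - 1))"
proof -
  have "{A \<in> k_subsets n k. A \<inter> {1..s + 1} = {}} = {A. A \<subseteq> {s + 1<..n} \<and> card A = k}"
  proof -
    have "A \<subseteq> {s + 1<..n} \<longleftrightarrow> A \<subseteq> {1..n} \<and> A \<inter> {1..s + 1} = {}" for A :: "nat set"
      by (auto simp: subset_eq disjoint_iff)
    then show ?thesis by (auto simp: k_subsets_def)
  qed
  then have "card {A \<in> k_subsets n k. A \<inter> {1..s + 1} = {}} = (n - s - 1) choose k"
    by (simp add: n_subsets)
  moreover have "(\<Sum>i\<le>s. card (link s (k_subsets n k) i)) = (s + 1) * ((n - s - 1) choose (k - 1))"
    using assms by (simp add: link_k_subsets n_subsets)
  moreover have "(n - s) choose k = ((n - s - 1) choose k) + ((n - s - 1) choose (k - 1))"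
    using assms choose_reduce_nat[of "n - s" k] by simp
  moreover have "card (k_subsets n k) = n choose k"
    by (simp add: k_subsets_def n_subsets)
  ultimately show ?thesis
    using card_split_by_trace[OF finite_k_subsets, of n k s] by (simp add: algebra_simps)
qed

section \<open>The bound for shifted families\<close>

text \<open>Members with trace of size at least 2 are bounded trivially and cancel against the full
  family. Those with empty trace cost \<open>s * card (L s)\<close>, whence the weight
  \<open>s + 1\<close> on the last link. Subtracted terms stand on the left and \<open>t\<close> is
  multiplied out to stay in the natural numbers.\<close>

lemma shifted_family_bound:
  assumes F: "F \<subseteq> k_subsets n k" and shifted: "shifted_above 0 F" and match: "matchings_at_most F s"
    and k: "2 \<le> k" and n: "s < n" and t: "t * (k - 1) \<le> n - s - 1"
  shows "t * (card F + ((n - s) choose k) + s * ((n - s - 1) choose (k - 1)))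
    \<le> t * (n choose k) + s * max t (2 * s + 1) * ((n - s - 1) choose (k - 1))"
proof -
  define L where "L = link s F"
  define F0 where "F0 = {A \<in> F. A \<inter> {1..s + 1} = {}}"
  have finF: "finite F" using F finite_k_subsets finite_subset by blast
  have L: "B \<subseteq> {s + 1<..n} \<and> card B = k - 1" if "i \<le> s" "B \<in> L i" for i B
    using link_k_subsets[OF that(1) n, of k] that(2) F k by (auto simp: L_def link_def)
  have shift: "insert i (A - {j}) \<in> F" if "A \<in> F" "j \<in> A" "0 < i" "i < j" "i \<notin> A" for A i j
    using shifted that by (auto simp: shifted_above_def)
  have "t * ((\<Sum>i<s. card (L i)) + (s + 1) * card (L s))
    \<le> s * max t (2 * s + 1) * (card {s + 1<..n} choose (k - 1))"
  proof (rule cross_dependent_sum_le)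
    show "L j \<subseteq> L i" if "i \<le> j" "j \<le> s" for i j
    proof
      fix B assume B: "B \<in> L j"
      then have mem: "insert (Suc j) B \<in> F" "B \<inter> {1..s + 1} = {}" by (auto simp: L_def link_def)
      have notin: "Suc i \<notin> B" "Suc j \<notin> B" using mem(2) that by auto
      show "B \<in> L i"
      proof (cases "i = j")
        case False
        then have "insert (Suc i) (insert (Suc j) B - {Suc j}) \<in> F"
          using mem notin that by (intro shift) auto
        then show ?thesis using mem notin by (simp add: L_def link_def)
      qed (use B in simp)
    qed
  next
    fix B assume B: "\<And>i. i \<le> s \<Longrightarrow> B i \<in> L i"
      and disj: "\<And>i j. i \<le> s \<Longrightarrow> j \<le> s \<Longrightarrow> i \<noteq> j \<Longrightarrow> disjnt (B i) (B j)"
    \<comment> \<open>Adjoining the distinct points \<open>Suc i\<close> turns disjoint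
      representatives of the links into a matching of size \<open>s + 1\<close> in
      \<open>F\<close>.\<close>
    define h where "h i = insert (Suc i) (B i)" for i
    have hF: "h i \<in> F" "B i \<inter> {1..s + 1} = {}" if "i \<le> s" for i
      using B[OF that] by (auto simp: L_def link_def h_def)
    have hd: "disjnt (h i) (h j)" if "i \<le> s" "j \<le> s" "i \<noteq> j" for i j
    proof -
      have "Suc i \<notin> B j" "Suc j \<notin> B i" using hF(2) that by force+
      then show ?thesis using disj[OF that] that(3) by (auto simp: h_def disjnt_def)
    qed
    have "inj_on h {..s}"
    proof (rule inj_onI, rule ccontr)
      fix i j assume "i \<in> {..s}" "j \<in> {..s}" "h i = h j" "i \<noteq> j"
      then show False using hd[of i j] by (auto simp: h_def disjnt_def)
    qed
    then have "card (h ` {..s}) = s + 1" by (simp add: card_image)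
    moreover have "h ` {..s} \<subseteq> F" using hF by auto
    moreover have "pairwise disjnt (h ` {..s})" using hd by (auto simp: pairwise_def)
    moreover have "finite (h ` {..s})" by simp
    ultimately have "s + 1 \<le> s" using match unfolding matchings_at_most_def by metis
    then show False by simp
  qed (use L k t n in auto)
  then have sum_bound: "t * ((\<Sum>i<s. card (L i)) + (s + 1) * card (L s))
    \<le> s * max t (2 * s + 1) * ((n - s - 1) choose (k - 1))" by simp
  have "card F0 \<le> s * card (shadow F0)"
  proof (rule card_le_shadow)
    show "A \<subseteq> {s + 1<..n} \<and> card A = k" if "A \<in> F0" for A
    proof -
      have "A \<subseteq> {1..n}" "card A = k" "A \<inter> {1..s + 1} = {}"
        using that F by (auto simp: F0_def k_subsets_def)
      moreover from this have "x \<in> {s + 1<..n}" if "x \<in> A" for x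
        using that by (metis IntI atLeastAtMost_iff empty_iff greaterThanAtMost_iff not_less subsetD)
      ultimately show ?thesis by auto
    qed
    show "shifted_above (s + 1) F0"
      unfolding shifted_above_def
    proof (intro ballI allI impI)
      fix A j i assume A: "A \<in> F0" "j \<in> A" "s + 1 < i" "i < j" "i \<notin> A"
      then have "insert i (A - {j}) \<in> F" by (intro shift) (auto simp: F0_def)
      with A(1,3) show "insert i (A - {j}) \<in> F0" by (auto simp: F0_def)
    qed
    show "matchings_at_most F0 s"
      using match by (auto simp: F0_def matchings_at_most_def)
  qed (use k in simp)
  also have "\<dots> \<le> s * card (L s)"
  proof (intro mult_left_mono card_mono)
    show "finite (L s)"
      using L[of s] by (intro finite_subset[of "L s" "Pow {s + 1<..n}"]) auto
    \<comment> \<open>The deleted point exceeds \<open>Suc s\<close>, so shifting it down to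
      \<open>Suc s\<close> stays in \<open>F\<close>.\<close>
    show "shadow F0 \<subseteq> L s"
    proof
      fix D assume "D \<in> shadow F0"
      then obtain A x where A: "A \<in> F" "A \<inter> {1..s + 1} = {}" "x \<in> A" "D = A - {x}"
        by (auto simp: shadow_def F0_def)
      have "A \<subseteq> {1..n}" using A(1) F by (auto simp: k_subsets_def)
      then have "x \<in> {1..n}" using A(3) by blast
      then have "Suc s < x" using A(2,3) by (auto simp: disjoint_iff not_less)
      moreover have "Suc s \<notin> A" using A(2) by auto
      ultimately have "insert (Suc s) (A - {x}) \<in> F" using A by (intro shift) auto
      then show "D \<in> L s" using A by (auto simp: L_def link_def)
    qed
  qed auto
  finally have "card F0 \<le> s * card (L s)" .
  moreover have "card {A \<in> F. 2 \<le> card (A \<inter> {1..s + 1})}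
      \<le> card {A \<in> k_subsets n k. 2 \<le> card (A \<inter> {1..s + 1})}"
    using F finite_k_subsets by (intro card_mono) auto
  moreover have "(\<Sum>i\<le>s. card (L i)) = (\<Sum>i<s. card (L i)) + card (L s)"
    by (simp add: lessThan_Suc_atMost[symmetric])
  ultimately have "card F + ((n - s) choose k) + s * ((n - s - 1) choose (k - 1))
    \<le> (n choose k) + ((\<Sum>i<s. card (L i)) + (s + 1) * card (L s))"
    using card_split_by_trace[OF finF, of s] binomial_split_by_trace[OF n, of k] k
    by (simp add: F0_def L_def)
  then have "t * (card F + ((n - s) choose k) + s * ((n - s - 1) choose (k - 1)))
    \<le> t * (n choose k) + t * ((\<Sum>i<s. card (L i)) + (s + 1) * card (L s))"
    by (metis distrib_left mult_le_mono2)
  with sum_bound show ?thesis by linarith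
qed

section \<open>Choice of \<open>t\<close> and the numerical estimates\<close>

theorem theorem1p8:
  fixes n k s :: nat and \<alpha> :: real and F :: "nat set set"
  assumes "k \<ge> 1"
    and "1 < \<alpha>" and "\<alpha> \<le> 2 - 1 / real k"
    and "real n \<ge> \<alpha> * real k * (real s + 1) + real k - 1"
    and "F \<subseteq> k_subsets n k"
    and "matching_number F = s"
  shows "real (card F) \<le> real (n choose k) - real ((n - s) choose k)
           + ((2 - \<alpha>) * real k - 1) / (\<alpha> * real k - 1) * real s * real ((n - s - 1) choose (k - 1))"
proof -
  \<comment> \<open>For \<open>k = 1\<close> the interval allowed for \<open>\<alpha>\<close> is
    empty.\<close>
  have k: "2 \<le> k" using assms(1-3) by (cases "k = 1") auto
  define b where "b = \<alpha> * real k - 1"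
  define l where "l = k - 1"
  have l: "0 < l" "real l = real k - 1" using k by (auto simp: l_def)
  have "1 * real k < \<alpha> * real k" using assms(2) k by (intro mult_strict_right_mono) auto
  moreover have "2 \<le> real k" using k by simp
  ultimately have b: "0 < b" unfolding b_def by linarith
  have "\<alpha> * real k \<le> (2 - 1 / real k) * real k" using assms(3) by (intro mult_right_mono) auto
  also have "\<dots> = 2 * real k - 1" using k by (simp add: left_diff_distrib)
  finally have b2: "b \<le> 2 * real l" using l by (simp add: b_def)
  have n: "real n \<ge> b * (real s + 1) + (real s + 1) + real l"
    using assms(4) l by (simp add: b_def algebra_simps)
  moreover have pos: "0 < b * (real s + 1)" using b by simp
  ultimately have "real s + 1 \<le> real n" by linarith
  then have sn: "s < n" by linarith
  define t where "t = (n - s - 1) div l"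
  have "n - s - 1 < t * l + l"
    using dividend_less_div_times[OF l(1)] by (simp add: t_def add.commute)
  then have "real n - real s - 1 < real t * real l + real l"
    using sn by (simp add: nat_less_real_le flip: of_nat_mult of_nat_add)
  \<comment> \<open>Rounding down in \<open>t\<close> loses less than \<open>l\<close>, which the
    summand \<open>k - 1\<close> in the hypothesis on \<open>n\<close> makes up for.\<close>
  then have tl: "b * (real s + 1) \<le> real t * real l" using n by linarith
  then have t: "0 < real t" using pos by (cases "t = 0") auto
  define c where "c = ((2 - \<alpha>) * real k - 1) / (\<alpha> * real k - 1)"
  have c: "1 + c = 2 * real l / b"
    using b(1) l by (simp add: c_def b_def field_simps)
  \<comment> \<open>The upper bound on \<open>\<alpha>\<close> gives \<open>b \<le> 2 * l\<close>,
    hence \<open>c \<ge> 0\<close>, which settles the first argument of \<open>max\<close>; the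
    second follows from \<open>tl\<close>.\<close>
  have "real t * 1 \<le> real t * (1 + c)"
    using b b2 t by (intro mult_left_mono) (auto simp: c)
  moreover have "2 * real s + 1 \<le> real t * (1 + c)"
  proof -
    have "(2 * real s + 1) * b \<le> 2 * (b * (real s + 1))" using b by (simp add: algebra_simps)
    also have "\<dots> \<le> 2 * (real t * real l)" using tl by simp
    finally show ?thesis using b(1) by (simp add: c field_simps)
  qed
  ultimately have max_le: "real (max t (2 * s + 1)) \<le> real t * (1 + c)" by simp
  have "finite F" using assms(5) finite_k_subsets finite_subset by blast
  then have "matchings_at_most F s" using matchings_at_most_matching_number assms(6) by blast
  then obtain F' where F': "F' \<subseteq> k_subsets n k" "card F' = card F" "matchings_at_most F' s"
    "shifted_above 0 F'"
    using exists_shifted[OF assms(5)] by blast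
  define X where "X = (n - s - 1) choose (k - 1)"
  have "t * (k - 1) \<le> n - s - 1" by (simp add: t_def l_def)
  from shifted_family_bound[OF F'(1,4,3) k sn this]
  have "t * (card F + ((n - s) choose k) + s * X) \<le> t * (n choose k) + s * max t (2 * s + 1) * X"
    by (simp only: F'(2) X_def)
  then have "real (t * (card F + ((n - s) choose k) + s * X))
      \<le> real (t * (n choose k) + s * max t (2 * s + 1) * X)"
    by (simp only: of_nat_le_iff)
  also have "\<dots> = real t * real (n choose k) + real s * real X * real (max t (2 * s + 1))"
    by (simp only: of_nat_add of_nat_mult mult_ac)
  also have "\<dots> \<le> real t * real (n choose k) + real s * real X * (real t * (1 + c))"
    using max_le by (intro add_left_mono mult_left_mono) auto
  finally have "real t * (real (card F) + real ((n - s) choose k) + real s * real X)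
      \<le> real t * (real (n choose k) + (1 + c) * (real s * real X))"
    by (simp add: algebra_simps)
  then have "real (card F) + real ((n - s) choose k) + real s * real X
      \<le> real (n choose k) + (1 + c) * (real s * real X)"
    using t by simp
  then show ?thesis by (simp add: c_def X_def algebra_simps)
qed

end
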